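(* Let $F$ be a field of characteristic zero and $n\in\mathbb N$. The $\Delta$-primitive idempotents in $\mathcal B_n$ are precisely the Lie idempotents in $\mathcal B_n$.
   Context: For a finite subset $A$ of $\mathbb N=\{1,2,\ldots\}$, a set composition of $A$ is a tuple $P=(P_1,\ldots,P_l)$ of mutually disjoint non-empty subsets of $A$ with union $A$; its type is the tuple $(\#P_1,\ldots,\#P_l)$; $\Pi_A$ is the set of all set compositions of $A$ and $\Pi_n=\Pi_{\{1,\ldots,n\}}$. $\Pi_\emptyset$ consists of the empty tuple, denoted $\emptyset$. $F\Pi_A$ is the $F$-vector space with basis $\Pi_A$, an associative algebra with identity under the bilinear product $(P_1,\ldots,P_l)\wedge(Q_1,\ldots,Q_k)=(P_1\cap Q_1,\ldots,P_1\cap Q_k,\ldots,P_l\cap Q_1,\ldots,P_l\cap Q_k)$ with empty sets deleted. $F\Pi=\bigoplus_AF\Pi_A$ over all finite $A\subset\mathbb N$. The coproduct $\Delta:F\Pi\to F\Pi\otimes F\Pi$ is the linear map with $\Delta(P)=\sum_{X\subseteq A}P|_X\otimes P|_{A\setminus X}$ for $P\in\Pi_A$, where $P|_X$ is $(P_1\cap X,\ldots,P_l\cap X)$ with empty sets deleted. A $\Delta$-primitive idempotent is a non-zero element $E$ with $\Delta(E)=E\otimes\emptyset+\emptyset\otimes E$ and $E\wedge E=E$. $S_n$ acts on $\Pi_n$ by $(P_1,\ldots,P_l)^\pi=(P_1\pi,\ldots,P_l\pi)$; $\mathcal B_n$ is the subalgebra of $S_n$-invariants in $F\Pi_n$, with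 basis $X^q=\sum_{\mathrm{type}(Q)=q}Q$, where $q$ ranges over the compositions of $n$ (finite sequences of positive integers with sum $n$). Put $$\Omega_n=\sum_{q=(q_1,\ldots,q_k)}(-1)^{k-1}q_1X^q\in\mathcal B_n,$$ the sum over all compositions $q$ of $n$ (this corresponds to the right-normed Dynkin operator in the Solomon descent algebra). A Lie idempotent in $\mathcal B_n$ is an element $E\in\mathcal B_n$ such that $\Omega_n\wedge E=nE$ and $E\wedge\Omega_n=\Omega_n$. *)

theory Defs
  imports Complex_Main "HOL-Library.Poly_Mapping" "HOL-Combinatorics.Permutations"
begin

text \<open>
  Since \<open>A\<close> is recovered from a set composition of \<open>A\<close> as the union of its blocks, the basis
  \<open>\<Union>A. \<Pi>\<^sub>A\<close> of \<open>F\<Pi>\<close> consists of lists of sets, and elements of \<open>F\<Pi>\<close> are finitely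
  supported functions on such lists.  As the type \<open>nat set list\<close> also contains lists that are
  not set compositions, \<open>F\<Pi>\<close> and \<open>F\<Pi>\<^sub>A\<close> are carved out by restricting the support.
\<close>

type_synonym set_comp = "nat set list"

definition set_comps :: "nat set \<Rightarrow> set_comp set" where
  "set_comps A = {P. sorted_wrt disjnt P \<and> {} \<notin> set P \<and> \<Union>(set P) = A}"

definition comp_type :: "set_comp \<Rightarrow> nat list" where
  "comp_type P = map card P"

definition FPi_on :: "nat set \<Rightarrow> (set_comp \<Rightarrow>\<^sub>0 'a::field) set" where
  "FPi_on A = {x. Poly_Mapping.keys x \<subseteq> set_comps A}"

definition FPi :: "(set_comp \<Rightarrow>\<^sub>0 'a::field) set" where
  "FPi = {x. Poly_Mapping.keys x \<subseteq> (\<Union>A\<in>{A. finite A \<and> A \<subseteq> {1..}}. set_comps A)}"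

definition scale :: "'a::field \<Rightarrow> ('b \<Rightarrow>\<^sub>0 'a) \<Rightarrow> ('b \<Rightarrow>\<^sub>0 'a)" where
  "scale c x = Poly_Mapping.map ((*) c) x"

definition lin_ext :: "('b \<Rightarrow> ('c \<Rightarrow>\<^sub>0 'a)) \<Rightarrow> ('b \<Rightarrow>\<^sub>0 'a) \<Rightarrow> ('c \<Rightarrow>\<^sub>0 'a::field)" where
  "lin_ext f x = (\<Sum>b\<in>Poly_Mapping.keys x. scale (Poly_Mapping.lookup x b) (f b))"

definition bilin_ext ::
    "('b \<Rightarrow> 'c \<Rightarrow> ('d \<Rightarrow>\<^sub>0 'a)) \<Rightarrow> ('b \<Rightarrow>\<^sub>0 'a) \<Rightarrow> ('c \<Rightarrow>\<^sub>0 'a) \<Rightarrow> ('d \<Rightarrow>\<^sub>0 'a::field)" where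
  "bilin_ext f x y = lin_ext (\<lambda>b. lin_ext (f b) y) x"

definition basis :: "'b \<Rightarrow> ('b \<Rightarrow>\<^sub>0 'a::field)" where
  "basis b = Poly_Mapping.single b 1"

definition drop_empty :: "set_comp \<Rightarrow> set_comp" where
  "drop_empty P = filter (\<lambda>B. B \<noteq> {}) P"

definition meet_comp :: "set_comp \<Rightarrow> set_comp \<Rightarrow> set_comp" where
  "meet_comp P Q = drop_empty [B \<inter> C. B \<leftarrow> P, C \<leftarrow> Q]"

text \<open>
  \<open>F\<Pi>\<close> is the direct sum of the algebras \<open>F\<Pi>\<^sub>A\<close>, so basis elements belonging to
  different sets \<open>A\<close> multiply to zero.
\<close>

definition wedge :: "(set_comp \<Rightarrow>\<^sub>0 'a) \<Rightarrow> (set_comp \<Rightarrow>\<^sub>0 'a) \<Rightarrow> (set_comp \<Rightarrow>\<^sub>0 'a::field)"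
    (infixl "\<and>\<^sub>\<Pi>" 70) where
  "x \<and>\<^sub>\<Pi> y =
     bilin_ext (\<lambda>P Q. if \<Union>(set P) = \<Union>(set Q) then basis (meet_comp P Q) else 0) x y"

definition restrict_comp :: "set_comp \<Rightarrow> nat set \<Rightarrow> set_comp" where
  "restrict_comp P X = drop_empty (map (\<lambda>B. B \<inter> X) P)"

text \<open>The tensor square of a space with basis \<open>B\<close> is the space with basis \<open>B \<times> B\<close>.\<close>

definition tensor :: "('b \<Rightarrow>\<^sub>0 'a) \<Rightarrow> ('c \<Rightarrow>\<^sub>0 'a) \<Rightarrow> ('b \<times> 'c \<Rightarrow>\<^sub>0 'a::field)"
    (infixl "\<otimes>\<^sub>F" 75) where
  "x \<otimes>\<^sub>F y = bilin_ext (\<lambda>b c. basis (b, c)) x y"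

definition coproduct :: "(set_comp \<Rightarrow>\<^sub>0 'a) \<Rightarrow> (set_comp \<times> set_comp \<Rightarrow>\<^sub>0 'a::field)" where
  "coproduct = lin_ext (\<lambda>P. \<Sum>X\<in>Pow (\<Union>(set P)).
     basis (restrict_comp P X) \<otimes>\<^sub>F basis (restrict_comp P (\<Union>(set P) - X)))"

definition delta_primitive_idempotent :: "(set_comp \<Rightarrow>\<^sub>0 'a::field) \<Rightarrow> bool" where
  "delta_primitive_idempotent E \<longleftrightarrow>
     E \<in> FPi \<and> E \<noteq> 0 \<and>
     coproduct E = E \<otimes>\<^sub>F basis [] + basis [] \<otimes>\<^sub>F E \<and>
     E \<and>\<^sub>\<Pi> E = E"

definition perm_act :: "(nat \<Rightarrow> nat) \<Rightarrow> (set_comp \<Rightarrow>\<^sub>0 'a) \<Rightarrow> (set_comp \<Rightarrow>\<^sub>0 'a::field)" where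
  "perm_act \<pi> = lin_ext (\<lambda>P. basis (map (image \<pi>) P))"

definition B_alg :: "nat \<Rightarrow> (set_comp \<Rightarrow>\<^sub>0 'a::field) set" where
  "B_alg n = {x \<in> FPi_on {1..n}. \<forall>\<pi>. \<pi> permutes {1..n} \<longrightarrow> perm_act \<pi> x = x}"

definition compositions :: "nat \<Rightarrow> nat list set" where
  "compositions n = {q. 0 \<notin> set q \<and> sum_list q = n}"

definition X_basis :: "nat \<Rightarrow> nat list \<Rightarrow> (set_comp \<Rightarrow>\<^sub>0 'a::field)" where
  "X_basis n q = (\<Sum>Q\<in>{Q \<in> set_comps {1..n}. comp_type Q = q}. basis Q)"

text \<open>Only used for \<open>n \<ge> 1\<close>, where every composition \<open>q\<close> of \<open>n\<close> is non-empty.\<close>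

definition Dynkin :: "nat \<Rightarrow> (set_comp \<Rightarrow>\<^sub>0 'a::field)" where
  "Dynkin n =
     (\<Sum>q\<in>compositions n. scale ((- 1) ^ (length q - 1) * of_nat (hd q)) (X_basis n q))"

definition Lie_idempotent :: "nat \<Rightarrow> (set_comp \<Rightarrow>\<^sub>0 'a::field) \<Rightarrow> bool" where
  "Lie_idempotent n E \<longleftrightarrow>
     E \<in> B_alg n \<and>
     Dynkin n \<and>\<^sub>\<Pi> E = scale (of_nat n) E \<and>
     E \<and>\<^sub>\<Pi> Dynkin n = Dynkin n"

end

theory Submission
  imports Defs
begin

text \<open>
  For a set composition \<open>P\<close> with \<open>P\<^sub>1\<close> as its first block, \<open>P \<and> (P\<^sub>1, A - P\<^sub>1) = P\<close>, so left
  multiplication by any \<open>P\<close> with at least two blocks factors through left multiplication by a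
  two-block composition \<open>(X, A - X)\<close>.  On the other hand \<open>(X, A - X) \<and> Q\<close> is the concatenation
  \<open>Q|\<^sub>X Q|\<^sub>A\<^sub>-\<^sub>X\<close>, from which both restrictions can be read off; hence \<open>(X, A - X) \<and> E\<close> vanishes
  exactly if the component of \<open>\<Delta>(E)\<close> in \<open>F\<Pi>\<^sub>X \<otimes> F\<Pi>\<^sub>A\<^sub>-\<^sub>X\<close> does.  So the primitive elements of
  \<open>F\<Pi>\<^sub>A\<close> are those annihilated from the left by all proper two-block compositions
  (\<open>primitive_iff_annihilated\<close>), and every \<open>x\<close> acts on such an element \<open>E\<close> from the left as the
  scalar \<open>x(A)\<close>, the coefficient in \<open>x\<close> of the one-block composition (\<open>wedge_annihilated\<close>).
  In particular, a primitive \<open>E\<close> is a non-zero idempotent if and only if \<open>E(A) = 1\<close>.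

  The element \<open>\<Omega>\<^sub>n\<close> is itself primitive (\<open>Dynkin_annihilated\<close>).  It is the sum over \<open>a \<in> {1..n}\<close> of
  \<open>\<Sum> (-1)\<^bsup>l(Q)-1\<^esup> Q\<close>, taken over the \<open>Q\<close> with \<open>a\<close> in the first block, and for each \<open>a\<close> a
  sign-reversing involution that leaves \<open>Q|\<^sub>X\<close> and \<open>Q|\<^sub>A\<^sub>-\<^sub>X\<close> unchanged cancels the terms of the
  product with \<open>(X, A - X)\<close>.

  The two descriptions now agree.  As \<open>\<Omega>\<^sub>n\<close> is primitive and non-zero, \<open>E \<and> \<Omega>\<^sub>n = \<Omega>\<^sub>n\<close> says that the
  coefficient of \<open>({1..n})\<close> in \<open>E\<close> is \<open>1\<close>.  If \<open>E\<close> is primitive, then \<open>\<Omega>\<^sub>n \<and> E = n E\<close>, because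
  \<open>n\<close> is the coefficient of \<open>({1..n})\<close> in \<open>\<Omega>\<^sub>n\<close>.  Conversely, \<open>\<Omega>\<^sub>n \<and> E = n E\<close> makes \<open>E\<close> a scalar
  multiple of \<open>\<Omega>\<^sub>n \<and> E\<close>, which by associativity is annihilated by whatever annihilates \<open>\<Omega>\<^sub>n\<close>.
\<close>

section \<open>Linear and bilinear extension\<close>

lemma lookup_scale [simp]: "Poly_Mapping.lookup (scale c x) k = c * Poly_Mapping.lookup x k"
  by (auto simp: scale_def Poly_Mapping.map.rep_eq when_def)

lemma lookup_basis: "Poly_Mapping.lookup (basis b) k = (if b = k then 1 else 0)"
  by (auto simp: basis_def lookup_single)

lemma scale_zero_right [simp]: "scale c 0 = 0"
  and scale_one [simp]: "scale 1 x = x"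
  and scale_scale [simp]: "scale c (scale d x) = scale (c * d) x"
  and scale_zero_left [simp]: "scale 0 x = 0"
  by (auto intro!: poly_mapping_eqI simp: algebra_simps)

lemma scale_sum_right: "scale c (\<Sum>i\<in>I. f i) = (\<Sum>i\<in>I. scale c (f i))"
  by (intro poly_mapping_eqI) (simp add: lookup_sum sum_distrib_left)

lemma keys_basis [simp]: "Poly_Mapping.keys (basis b :: 'b \<Rightarrow>\<^sub>0 'a::field) = {b}"
  by (simp add: basis_def)

lemma lin_ext_superset:
  assumes "finite S" "Poly_Mapping.keys x \<subseteq> S"
  shows "lin_ext f x = (\<Sum>b\<in>S. scale (Poly_Mapping.lookup x b) (f b))"
  unfolding lin_ext_def
  by (rule sum.mono_neutral_left) (use assms in \<open>auto simp: in_keys_iff\<close>)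

lemma lin_ext_zero [simp]: "lin_ext f 0 = 0"
  by (simp add: lin_ext_def)

lemma lin_ext_basis [simp]: "lin_ext f (basis b) = f b"
  by (simp add: lin_ext_def lookup_basis)

lemma lin_ext_scale: "lin_ext f (scale c x) = scale c (lin_ext f x)"
proof -
  have "Poly_Mapping.keys (scale c x) \<subseteq> Poly_Mapping.keys x"
    by (auto simp: in_keys_iff)
  then have "lin_ext f (scale c x)
      = (\<Sum>b\<in>Poly_Mapping.keys x. scale (Poly_Mapping.lookup (scale c x) b) (f b))"
    by (intro lin_ext_superset) auto
  then show ?thesis by (simp add: lin_ext_def scale_sum_right)
qed

lemma lin_ext_add: "lin_ext f (x + y) = lin_ext f x + lin_ext f y"
proof -
  let ?S = "Poly_Mapping.keys x \<union> Poly_Mapping.keys y"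
  have "lin_ext f z = (\<Sum>b\<in>?S. scale (Poly_Mapping.lookup z b) (f b))"
    if "Poly_Mapping.keys z \<subseteq> ?S" for z
    using that by (intro lin_ext_superset) auto
  moreover have "Poly_Mapping.keys (x + y) \<subseteq> ?S" by (rule Poly_Mapping.keys_add)
  ultimately show ?thesis
    by (auto intro!: poly_mapping_eqI
        simp: lookup_add lookup_sum algebra_simps simp flip: sum.distrib)
qed

lemma lin_ext_sum: "lin_ext f (\<Sum>i\<in>I. g i) = (\<Sum>i\<in>I. lin_ext f (g i))"
  by (induction I rule: infinite_finite_induct) (simp_all add: lin_ext_add)

lemma lin_ext_sum_fun: "lin_ext (\<lambda>b. \<Sum>i\<in>I. f i b) x = (\<Sum>i\<in>I. lin_ext (f i) x)"
  unfolding lin_ext_def by (simp add: scale_sum_right sum.swap[of _ I])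

lemma lin_ext_cong:
  "(\<And>b. b \<in> Poly_Mapping.keys x \<Longrightarrow> f b = g b) \<Longrightarrow> lin_ext f x = lin_ext g x"
  by (auto simp: lin_ext_def intro: sum.cong)

lemma lin_ext_zero_fun [simp]: "lin_ext (\<lambda>b. 0) x = 0"
  by (simp add: lin_ext_def)

lemma lin_ext_basis_fun [simp]: "lin_ext basis x = x"
  by (intro poly_mapping_eqI)
    (auto simp: lin_ext_def lookup_sum lookup_basis in_keys_iff if_distrib sum.delta' cong: if_cong)

lemma lin_ext_lin_ext: "lin_ext g (lin_ext f x) = lin_ext (\<lambda>b. lin_ext g (f b)) x"
  unfolding lin_ext_def[of f x] lin_ext_def[of "\<lambda>b. lin_ext g (f b)" x]
  by (simp add: lin_ext_sum lin_ext_scale)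

lemma lin_ext_swap:
  "lin_ext (\<lambda>a. lin_ext (f a) y) x = lin_ext (\<lambda>b. lin_ext (\<lambda>a. f a b) x) y"
  unfolding lin_ext_def
  by (simp add: scale_sum_right mult.commute sum.swap[of _ "Poly_Mapping.keys y"])

lemma tensor_basis_right: "x \<otimes>\<^sub>F basis c = lin_ext (\<lambda>b. basis (b, c)) x"
  by (simp add: tensor_def bilin_ext_def)

lemma tensor_basis_left: "basis b \<otimes>\<^sub>F y = lin_ext (\<lambda>c. basis (b, c)) y"
  by (simp add: tensor_def bilin_ext_def)

section \<open>Restriction and product of set compositions\<close>

lemma drop_empty_simps [simp]:
  "drop_empty [] = []"
  "drop_empty (B # P) = (if B = {} then drop_empty P else B # drop_empty P)"
  "drop_empty (P @ Q) = drop_empty P @ drop_empty Q"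
  by (auto simp: drop_empty_def)

lemma restrict_comp_simps [simp]:
  "restrict_comp [] X = []"
  "restrict_comp (B # P) X = (if B \<inter> X = {} then restrict_comp P X else (B \<inter> X) # restrict_comp P X)"
  "restrict_comp (P @ Q) X = restrict_comp P X @ restrict_comp Q X"
  by (auto simp: restrict_comp_def)

lemma meet_comp_simps [simp]:
  "meet_comp [] Q = []"
  "meet_comp (B # P) Q = restrict_comp Q B @ meet_comp P Q"
proof -
  have "(\<inter>) B = (\<lambda>C. C \<inter> B)" by auto
  then show "meet_comp (B # P) Q = restrict_comp Q B @ meet_comp P Q"
    by (simp add: meet_comp_def restrict_comp_def)
qed (simp add: meet_comp_def)

lemma meet_comp_append [simp]: "meet_comp (P @ P') Q = meet_comp P Q @ meet_comp P' Q"
  by (induction P) auto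

lemma Union_restrict_comp [simp]: "\<Union>(set (restrict_comp P X)) = \<Union>(set P) \<inter> X"
  by (induction P) auto

lemma Union_meet_comp [simp]: "\<Union>(set (meet_comp P Q)) = \<Union>(set P) \<inter> \<Union>(set Q)"
  by (induction P) auto

lemma restrict_restrict_comp [simp]: "restrict_comp (restrict_comp P X) Y = restrict_comp P (X \<inter> Y)"
  by (induction P) (auto simp: Int_assoc)

lemma restrict_comp_empty [simp]: "restrict_comp P {} = []"
  by (induction P) auto

text \<open>
  Intersecting the blocks of \<open>P \<and> Q\<close> with \<open>X\<close> may be done on the blocks of \<open>P\<close> beforehand.  This is
  the inductive step of associativity, since \<open>meet_comp\<close> is built from restrictions to the blocks of
  its first argument.
\<close>

lemma restrict_comp_meet_comp: "restrict_comp (meet_comp P Q) X = meet_comp (restrict_comp P X) Q"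
  by (induction P) (auto simp: Int_commute)

lemma meet_comp_assoc: "meet_comp (meet_comp P Q) R = meet_comp P (meet_comp Q R)"
  by (induction P) (auto simp: restrict_comp_meet_comp)

lemma restrict_comp_superset:
  "{} \<notin> set P \<Longrightarrow> \<Union>(set P) \<subseteq> X \<Longrightarrow> restrict_comp P X = P"
  by (induction P) (auto simp: Int_absorb2)

lemma restrict_set_comps:
  assumes "P \<in> set_comps A" "A \<subseteq> X"
  shows "restrict_comp P X = P"
  using assms by (intro restrict_comp_superset) (auto simp: set_comps_def)

text \<open>
  A composition is unchanged when multiplied from the right by a coarser one, whatever the order of
  the coarser blocks.  It is used with \<open>X\<close> the first block of \<open>P\<close>.
\<close>

lemma meet_comp_coarser:
  assumes "{} \<notin> set P" "\<And>B. B \<in> set P \<Longrightarrow> B \<subseteq> X \<or> B \<subseteq> Y" "X \<inter> Y = {}"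
  shows "meet_comp P [X, Y] = P"
  using assms
proof (induction P)
  case (Cons B P)
  from Cons.prems have "B \<subseteq> X \<or> B \<subseteq> Y" "B \<noteq> {}" by auto
  then have "(X \<inter> B = B \<and> Y \<inter> B = {}) \<or> (X \<inter> B = {} \<and> Y \<inter> B = B)"
    using Cons.prems(3) by blast
  moreover have "meet_comp P [X, Y] = P" using Cons by simp
  ultimately show ?case using \<open>B \<noteq> {}\<close> by auto
qed simp

lemma set_comps_ConsD:
  assumes "B # P \<in> set_comps A"
  shows "B \<noteq> {}" "B \<subseteq> A" "P \<in> set_comps (A - B)"
  using assms by (auto simp: set_comps_def disjnt_def)

lemma finite_set_comps:
  assumes "finite A"
  shows "finite (set_comps A)"
proof (rule finite_subset)
  have "distinct P" if "sorted_wrt disjnt P" "{} \<notin> set P" for P :: set_comp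
    using that by (induction P) (auto simp: disjnt_def)
  then show "set_comps A \<subseteq> {P. set P \<subseteq> Pow A \<and> distinct P}"
    by (auto simp: set_comps_def)
  show "finite {P. set P \<subseteq> Pow A \<and> distinct P}"
    using assms by (intro finite_subset_distinct) auto
qed

section \<open>The algebra structure\<close>

lemma wedge_basis_basis:
  "basis P \<and>\<^sub>\<Pi> basis Q = (if \<Union>(set P) = \<Union>(set Q) then basis (meet_comp P Q) else 0)"
  by (simp add: wedge_def bilin_ext_def)

lemma wedge_basis_left: "basis P \<and>\<^sub>\<Pi> y = lin_ext (\<lambda>Q. basis P \<and>\<^sub>\<Pi> basis Q) y"
  by (simp add: wedge_def bilin_ext_def)

lemma wedge_left: "x \<and>\<^sub>\<Pi> y = lin_ext (\<lambda>P. basis P \<and>\<^sub>\<Pi> y) x"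
  by (simp add: wedge_def bilin_ext_def)

lemma wedge_lin_ext_left: "lin_ext f x \<and>\<^sub>\<Pi> y = lin_ext (\<lambda>b. f b \<and>\<^sub>\<Pi> y) x"
  by (simp add: wedge_def bilin_ext_def lin_ext_lin_ext)

lemma wedge_lin_ext_right: "x \<and>\<^sub>\<Pi> lin_ext f y = lin_ext (\<lambda>b. x \<and>\<^sub>\<Pi> f b) y"
  unfolding wedge_def bilin_ext_def lin_ext_lin_ext by (rule lin_ext_swap)

lemma wedge_zero_left [simp]: "0 \<and>\<^sub>\<Pi> y = 0"
  by (simp add: wedge_def bilin_ext_def)

lemma wedge_zero_right [simp]: "x \<and>\<^sub>\<Pi> 0 = 0"
  by (simp add: wedge_def bilin_ext_def)

text \<open>
  Although products of compositions of different sets are \<open>0\<close>, associativity survives on arbitrary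
  lists of sets: the union of the blocks of a product of two lists with the same union is that
  union, so both sides are \<open>0\<close> under the same condition.
\<close>

lemma wedge_basis_assoc:
  "(basis P \<and>\<^sub>\<Pi> basis Q) \<and>\<^sub>\<Pi> basis R = basis P \<and>\<^sub>\<Pi> (basis Q \<and>\<^sub>\<Pi> basis R)"
  by (cases "\<Union>(set P) = \<Union>(set Q)"; cases "\<Union>(set Q) = \<Union>(set R)")
    (simp_all add: wedge_basis_basis meet_comp_assoc)

lemma wedge_assoc: "(x \<and>\<^sub>\<Pi> y) \<and>\<^sub>\<Pi> z = x \<and>\<^sub>\<Pi> (y \<and>\<^sub>\<Pi> z)"
proof -
  have "(lin_ext basis x \<and>\<^sub>\<Pi> lin_ext basis y) \<and>\<^sub>\<Pi> lin_ext basis z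
      = lin_ext (\<lambda>P. lin_ext (\<lambda>Q. lin_ext (\<lambda>R. (basis P \<and>\<^sub>\<Pi> basis Q) \<and>\<^sub>\<Pi> basis R) z) y) x"
    \<comment> \<open>The order of expansion fixes the nesting: first \<open>x\<close>, then \<open>y\<close>, then \<open>z\<close>.\<close>
    unfolding wedge_lin_ext_left wedge_lin_ext_right[of "basis P" for P] wedge_lin_ext_left
    unfolding wedge_lin_ext_right ..
  also have "\<dots> = lin_ext basis x \<and>\<^sub>\<Pi> (lin_ext basis y \<and>\<^sub>\<Pi> lin_ext basis z)"
    unfolding wedge_basis_assoc wedge_lin_ext_left unfolding wedge_lin_ext_right ..
  finally show ?thesis by simp
qed

lemma wedge_basis_FPi_on:
  assumes "E \<in> FPi_on A" "\<Union>(set P) = A"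
  shows "basis P \<and>\<^sub>\<Pi> E = lin_ext (\<lambda>Q. basis (meet_comp P Q)) E"
  unfolding wedge_basis_left[of P E]
proof (rule lin_ext_cong)
  fix Q assume "Q \<in> Poly_Mapping.keys E"
  then have "\<Union>(set Q) = A" using assms(1) by (auto simp: FPi_on_def set_comps_def)
  then show "basis P \<and>\<^sub>\<Pi> basis Q = basis (meet_comp P Q)"
    using assms(2) by (simp add: wedge_basis_basis)
qed

lemma wedge_scale_right: "x \<and>\<^sub>\<Pi> scale c y = scale c (x \<and>\<^sub>\<Pi> y)"
  by (simp add: wedge_def bilin_ext_def lin_ext_scale)
    (simp add: lin_ext_def scale_sum_right mult.left_commute)

section \<open>Primitive elements\<close>

text \<open>
  For complementary subsets \<open>X\<close> and \<open>Y\<close> of \<open>A\<close> this is the component of the coproduct in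
  \<open>F\<Pi>\<^sub>X \<otimes> F\<Pi>\<^sub>Y\<close>.
\<close>

definition split_at :: "nat set \<Rightarrow> nat set \<Rightarrow> (set_comp \<Rightarrow>\<^sub>0 'a::field) \<Rightarrow> (set_comp \<times> set_comp \<Rightarrow>\<^sub>0 'a)" where
  "split_at X Y = lin_ext (\<lambda>P. basis (restrict_comp P X, restrict_comp P Y))"

lemma coproduct_FPi_on:
  assumes "E \<in> FPi_on A"
  shows "coproduct E = (\<Sum>X\<in>Pow A. split_at X (A - X) E)"
proof -
  have "coproduct E = lin_ext (\<lambda>P. \<Sum>X\<in>Pow A.
          basis (restrict_comp P X, restrict_comp P (A - X))) E"
    unfolding coproduct_def
    by (rule lin_ext_cong)
      (use assms in \<open>auto simp: FPi_on_def set_comps_def tensor_basis_right\<close>)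
  then show ?thesis by (simp add: lin_ext_sum_fun split_at_def)
qed

lemma split_at_trivial:
  assumes "E \<in> FPi_on A"
  shows "split_at A {} E = E \<otimes>\<^sub>F basis []" "split_at {} A E = basis [] \<otimes>\<^sub>F E"
  unfolding split_at_def tensor_basis_right tensor_basis_left
  by (rule lin_ext_cong; use assms restrict_set_comps[OF _ order_refl] in \<open>auto simp: FPi_on_def\<close>)+

text \<open>
  The product \<open>(X, Y) \<and> E\<close> is the image of \<open>split_at X Y E\<close> under concatenation
  \<open>R \<otimes> S \<mapsto> R S\<close>.  Restricting a concatenation to \<open>X\<close> and to \<open>Y\<close> recovers \<open>R\<close> and \<open>S\<close>, so
  \<open>split_at X Y\<close> is a left inverse of it here.
\<close>

lemma split_at_eq_0_iff:
  assumes "E \<in> FPi_on A" "X \<union> Y = A" "X \<inter> Y = {}"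
  shows "split_at X Y E = 0 \<longleftrightarrow> basis [X, Y] \<and>\<^sub>\<Pi> E = 0"
proof -
  have *: "basis [X, Y] \<and>\<^sub>\<Pi> E = lin_ext (\<lambda>P. basis (restrict_comp P X @ restrict_comp P Y)) E"
    using wedge_basis_FPi_on[OF assms(1), of "[X, Y]"] assms by simp
  have "basis [X, Y] \<and>\<^sub>\<Pi> E = lin_ext (\<lambda>(R, S). basis (R @ S)) (split_at X Y E)"
    unfolding * split_at_def lin_ext_lin_ext by simp
  moreover have "split_at X Y E = split_at X Y (basis [X, Y] \<and>\<^sub>\<Pi> E)"
    using assms(3) unfolding * split_at_def lin_ext_lin_ext
    by (simp add: Int_commute)
  moreover have "split_at X Y 0 = 0" by (simp add: split_at_def)
  ultimately show ?thesis by (metis (no_types, lifting) lin_ext_zero)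
qed

lemma lookup_split_at_eq_0:
  assumes "E \<in> FPi_on A" "X \<subseteq> A" "\<Union>(set R) \<noteq> X"
  shows "Poly_Mapping.lookup (split_at X Y E) (R, S) = 0"
proof -
  have "restrict_comp P X \<noteq> R" if "P \<in> Poly_Mapping.keys E" for P
  proof -
    have "\<Union>(set P) = A" using that assms(1) by (auto simp: FPi_on_def set_comps_def)
    then have "\<Union>(set (restrict_comp P X)) = X" using assms(2) by (simp add: Int_absorb1)
    then show ?thesis using assms(3) by blast
  qed
  then show ?thesis
    by (auto simp: split_at_def lin_ext_def lookup_sum lookup_basis intro!: sum.neutral)
qed

text \<open>
  The components of the coproduct at \<open>X = A\<close> and \<open>X = {}\<close> are the two required terms.  The remaining
  ones lie in different summands \<open>F\<Pi>\<^sub>X \<otimes> F\<Pi>\<^sub>A\<^sub>-\<^sub>X\<close>, so their sum vanishes only if each of them does.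
\<close>

lemma primitive_iff_annihilated:
  assumes "E \<in> FPi_on A" "finite A" "A \<noteq> {}"
  shows "coproduct E = E \<otimes>\<^sub>F basis [] + basis [] \<otimes>\<^sub>F E \<longleftrightarrow>
    (\<forall>X. X \<subset> A \<and> X \<noteq> {} \<longrightarrow> basis [X, A - X] \<and>\<^sub>\<Pi> E = 0)"
proof -
  let ?I = "{X. X \<subset> A \<and> X \<noteq> {}}"
  have fin: "finite ?I" by (rule finite_subset[of _ "Pow A"]) (use assms in auto)
  have Pow: "Pow A = insert A (insert {} ?I)" by auto
  have "coproduct E = E \<otimes>\<^sub>F basis [] + basis [] \<otimes>\<^sub>F E + (\<Sum>X\<in>?I. split_at X (A - X) E)"
    unfolding coproduct_FPi_on[OF assms(1)] Pow using fin assms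
    by (simp add: split_at_trivial add.assoc)
  then have "coproduct E = E \<otimes>\<^sub>F basis [] + basis [] \<otimes>\<^sub>F E \<longleftrightarrow> (\<Sum>X\<in>?I. split_at X (A - X) E) = 0"
    by simp
  also have "\<dots> \<longleftrightarrow> (\<forall>X\<in>?I. split_at X (A - X) E = 0)"
  proof (intro iffI ballI)
    fix X assume sum0: "(\<Sum>X\<in>?I. split_at X (A - X) E) = 0" and X: "X \<in> ?I"
    show "split_at X (A - X) E = 0"
    proof (rule poly_mapping_eqI, clarify)
      fix R S
      show "Poly_Mapping.lookup (split_at X (A - X) E) (R, S) = Poly_Mapping.lookup 0 (R, S)"
      proof (cases "\<Union>(set R) = X")
        case True
        have "0 = (\<Sum>Z\<in>?I. Poly_Mapping.lookup (split_at Z (A - Z) E) (R, S))"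
          using arg_cong[OF sum0, of "\<lambda>x. Poly_Mapping.lookup x (R, S)"] by (simp add: lookup_sum)
        also have "\<dots> = (\<Sum>Z\<in>{X}. Poly_Mapping.lookup (split_at Z (A - Z) E) (R, S))"
          by (rule sum.mono_neutral_right)
            (use fin X True in \<open>auto intro!: lookup_split_at_eq_0[OF assms(1)]\<close>)
        finally show ?thesis by simp
      next
        case False
        then show ?thesis using lookup_split_at_eq_0[OF assms(1) _ False] X by (simp add: psubset_imp_subset)
      qed
    qed
  qed simp
  also have "\<dots> \<longleftrightarrow> (\<forall>X. X \<subset> A \<and> X \<noteq> {} \<longrightarrow> basis [X, A - X] \<and>\<^sub>\<Pi> E = 0)"
    using split_at_eq_0_iff[OF assms(1)] by (auto simp: Un_absorb1 psubset_imp_subset)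
  finally show ?thesis .
qed

text \<open>
  A composition other than \<open>(A)\<close> has a first block \<open>B \<noteq> A\<close>, and
  \<open>P \<and> E = P \<and> ((B, A - B) \<and> E) = 0\<close>; only the term of \<open>(A)\<close>, the identity of \<open>F\<Pi>\<^sub>A\<close>, contributes.
\<close>

lemma wedge_annihilated:
  assumes x: "x \<in> FPi_on A" and E: "E \<in> FPi_on A" and A: "A \<noteq> {}"
    and ann: "\<And>X. X \<subset> A \<Longrightarrow> X \<noteq> {} \<Longrightarrow> basis [X, A - X] \<and>\<^sub>\<Pi> E = 0"
  shows "x \<and>\<^sub>\<Pi> E = scale (Poly_Mapping.lookup x [A]) E"
proof -
  have "basis P \<and>\<^sub>\<Pi> E = (if P = [A] then E else 0)" if P: "P \<in> set_comps A" for P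
  proof (cases "P = [A]")
    case True
    have "basis [A] \<and>\<^sub>\<Pi> E = lin_ext basis E"
      by (subst wedge_basis_FPi_on[OF E])
        (use E in \<open>auto intro!: lin_ext_cong simp: FPi_on_def restrict_set_comps simp del: lin_ext_basis_fun\<close>)
    with True show ?thesis by simp
  next
    case False
    from A P obtain B P' where BP: "P = B # P'" by (cases P) (auto simp: set_comps_def)
    note B = set_comps_ConsD[OF P[unfolded BP]]
    have "B \<noteq> A"
    proof
      assume "B = A"
      then have "P' \<in> set_comps {}" using B by simp
      then have "P' = []" by (cases P') (auto simp: set_comps_def)
      with False BP \<open>B = A\<close> show False by simp
    qed
    have "meet_comp P [B, A - B] = P"
      by (rule meet_comp_coarser) (use P BP B in \<open>auto simp: set_comps_def\<close>)
    then have "basis P \<and>\<^sub>\<Pi> basis [B, A - B] = (basis P :: set_comp \<Rightarrow>\<^sub>0 'a)"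
      using P B by (auto simp: wedge_basis_basis set_comps_def)
    then have "basis P \<and>\<^sub>\<Pi> E = basis P \<and>\<^sub>\<Pi> (basis [B, A - B] \<and>\<^sub>\<Pi> E)"
      by (metis wedge_assoc)
    also have "\<dots> = 0"
      using ann[of B] B \<open>B \<noteq> A\<close> by (simp add: psubset_eq)
    finally show ?thesis using False by simp
  qed
  then have "x \<and>\<^sub>\<Pi> E = lin_ext (\<lambda>P. if P = [A] then E else 0) x"
    unfolding wedge_left[of x] using x by (intro lin_ext_cong) (auto simp: FPi_on_def)
  also have "\<dots> = scale (Poly_Mapping.lookup x [A]) E"
    by (auto simp: lin_ext_def if_distrib sum.delta in_keys_iff cong: if_cong)
  finally show ?thesis .
qed

section \<open>Primitivity of the Dynkin element\<close>

text \<open>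
  The sign-reversing involution.  Look for the first block that meets \<open>Y\<close>.  If it has elements
  outside \<open>Y\<close>, these are split off as a block of their own in front of the rest; if it is contained
  in \<open>Y\<close>, it is merged with the preceding block, which is disjoint from \<open>Y\<close>.  These two moves undo
  each other.  Merging needs a preceding block, so the first block must not be contained in \<open>Y\<close>
  (otherwise the value has an empty block): this holds when it contains a given point \<open>a \<notin> Y\<close>, a property that both moves preserve.
\<close>

fun toggle :: "nat set \<Rightarrow> set_comp \<Rightarrow> set_comp" where
  "toggle Y [] = []"
| "toggle Y [B] = (if B \<inter> Y = {} then [B] else [B - Y, B \<inter> Y])"
| "toggle Y (B # C # P) =
    (if B \<inter> Y \<noteq> {} then (B - Y) # (B \<inter> Y) # C # P
     else if C \<subseteq> Y then (B \<union> C) # P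
     else B # toggle Y (C # P))"

lemma hd_toggle_minus: "P \<noteq> [] \<Longrightarrow> hd (toggle Y P) - Y = hd P - Y"
  by (cases "(Y, P)" rule: toggle.cases) auto

lemma toggle_eq_Nil [simp]: "toggle Y P = [] \<longleftrightarrow> P = []"
  by (cases "(Y, P)" rule: toggle.cases) auto

lemma Union_toggle [simp]: "\<Union>(set (toggle Y P)) = \<Union>(set P)"
  by (induction Y P rule: toggle.induct) auto

lemma empty_notin_toggle:
  "{} \<notin> set P \<Longrightarrow> P = [] \<or> \<not> hd P \<subseteq> Y \<Longrightarrow> {} \<notin> set (toggle Y P)"
  by (induction Y P rule: toggle.induct) auto

lemma disjoint_Cons_iff:
  "sorted_wrt disjnt (B # P) \<longleftrightarrow> B \<inter> \<Union>(set P) = {} \<and> sorted_wrt disjnt P"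
  by (auto simp: disjnt_def)

lemma disjoint_toggle: "sorted_wrt disjnt P \<Longrightarrow> sorted_wrt disjnt (toggle Y P)"
proof (induction Y P rule: toggle.induct)
  case (2 Y B)
  then show ?case by (auto simp: disjnt_def)
next
  case (3 Y B C P)
  have B: "B \<inter> \<Union>(set (C # P)) = {}" and C: "C \<inter> \<Union>(set P) = {}"
    and P: "sorted_wrt disjnt (C # P)" "sorted_wrt disjnt P"
    using 3 unfolding disjoint_Cons_iff by blast+
  consider (split) "B \<inter> Y \<noteq> {}" | (merge) "B \<inter> Y = {}" "C \<subseteq> Y"
    | (skip) "B \<inter> Y = {}" "\<not> C \<subseteq> Y" by blast
  then show ?case
  proof cases
    case split
    have "(B - Y) \<inter> \<Union>(set ((B \<inter> Y) # C # P)) = {}" "(B \<inter> Y) \<inter> \<Union>(set (C # P)) = {}"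
      using B by auto
    then have "sorted_wrt disjnt ((B - Y) # (B \<inter> Y) # C # P)"
      unfolding disjoint_Cons_iff[of "B - Y"] disjoint_Cons_iff[of "B \<inter> Y"] using P by blast
    with split show ?thesis by simp
  next
    case merge
    have "(B \<union> C) \<inter> \<Union>(set P) = {}" using B C by auto
    then have "sorted_wrt disjnt ((B \<union> C) # P)"
      unfolding disjoint_Cons_iff[of "B \<union> C"] using P by blast
    with merge show ?thesis by simp
  next
    case skip
    have "sorted_wrt disjnt (toggle Y (C # P))" using 3 skip P by blast
    then have "sorted_wrt disjnt (B # toggle Y (C # P))"
      unfolding disjoint_Cons_iff[of B] Union_toggle using B by blast
    with skip show ?thesis by simp
  qed
qed simp

lemma toggle_Cons_meets: "B \<inter> Y \<noteq> {} \<Longrightarrow> toggle Y (B # P) = (B - Y) # (B \<inter> Y) # P"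
  by (cases P) auto

lemma toggle_toggle:
  "{} \<notin> set P \<Longrightarrow> P = [] \<or> \<not> hd P \<subseteq> Y \<Longrightarrow> toggle Y (toggle Y P) = P"
proof (induction Y P rule: toggle.induct)
  case (2 Y B)
  have "(B - Y) \<inter> Y = {}" "B \<inter> Y \<subseteq> Y" "(B - Y) \<union> (B \<inter> Y) = B" by blast+
  then show ?case by simp
next
  case (3 Y B C P)
  consider (split) "B \<inter> Y \<noteq> {}" | (merge) "B \<inter> Y = {}" "C \<subseteq> Y"
    | (skip) "B \<inter> Y = {}" "\<not> C \<subseteq> Y" by blast
  then show ?case
  proof cases
    case split
    have "(B - Y) \<inter> Y = {}" "B \<inter> Y \<subseteq> Y" "(B - Y) \<union> (B \<inter> Y) = B" by blast+
    with split show ?thesis by simp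
  next
    case merge
    have "C \<noteq> {}" using 3 by auto
    with merge have "(B \<union> C) \<inter> Y \<noteq> {}" "(B \<union> C) - Y = B" "(B \<union> C) \<inter> Y = C" by blast+
    with merge show ?thesis by (simp add: toggle_Cons_meets)
  next
    case skip
    \<comment> \<open>The recursive call keeps the first block outside \<open>Y\<close>, so the second pass skips \<open>B\<close> again.\<close>
    obtain D R where DR: "toggle Y (C # P) = D # R"
      by (cases "toggle Y (C # P)") auto
    then have "D - Y = C - Y"
      using hd_toggle_minus[of "C # P" Y] by simp
    then have "\<not> D \<subseteq> Y" using skip by blast
    moreover have "toggle Y (D # R) = C # P"
      using "3.IH" "3.prems" skip DR by simp
    ultimately show ?thesis using skip DR by simp
  qed
qed simp

lemma length_toggle:
  "\<Union>(set P) \<inter> Y \<noteq> {} \<Longrightarrow> length (toggle Y P) = Suc (length P) \<or> length P = Suc (length (toggle Y P))"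
proof (induction Y P rule: toggle.induct)
  case (3 Y B C P)
  then show ?case by (cases "B \<inter> Y = {}"; cases "C \<subseteq> Y") (simp_all add: Int_Un_distrib2)
qed auto

text \<open>
  Splitting a block into its parts outside and inside \<open>Y\<close> cannot be seen after restriction to a set
  on one side of \<open>Y\<close>, where one of the two parts becomes empty.  Read backwards, the same holds for
  merging, so restrictions are invariant under \<open>toggle\<close>.
\<close>

lemma restrict_comp_split_block:
  assumes "Z \<subseteq> Y \<or> Z \<inter> Y = {}"
  shows "restrict_comp ((B - Y) # (B \<inter> Y) # P) Z = restrict_comp (B # P) Z"
  using assms
proof
  assume "Z \<subseteq> Y"
  then have "(B - Y) \<inter> Z = {}" "B \<inter> Y \<inter> Z = B \<inter> Z" by blast+
  then show ?thesis by simp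
next
  assume "Z \<inter> Y = {}"
  then have "(B - Y) \<inter> Z = B \<inter> Z" "B \<inter> Y \<inter> Z = {}" by blast+
  then show ?thesis by simp
qed

lemma restrict_toggle:
  assumes "Z \<subseteq> Y \<or> Z \<inter> Y = {}"
  shows "restrict_comp (toggle Y P) Z = restrict_comp P Z"
  using assms
proof (induction Y P rule: toggle.induct)
  case (2 Y B)
  then show ?case using restrict_comp_split_block[of Z Y B "[]"]
    by (simp del: restrict_comp_simps)
next
  case (3 Y B C P)
  consider (split) "B \<inter> Y \<noteq> {}" | (merge) "B \<inter> Y = {}" "C \<subseteq> Y"
    | (skip) "B \<inter> Y = {}" "\<not> C \<subseteq> Y" by blast
  then show ?case
  proof cases
    case split
    then show ?thesis using restrict_comp_split_block[of Z Y B "C # P"] 3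
      by (simp del: restrict_comp_simps)
  next
    case merge
    then have "(B \<union> C) - Y = B" "(B \<union> C) \<inter> Y = C" by blast+
    with merge show ?thesis using restrict_comp_split_block[of Z Y "B \<union> C" P] 3
      by (simp del: restrict_comp_simps)
  next
    case skip
    have "restrict_comp (toggle Y (C # P)) Z = restrict_comp (C # P) Z"
      using "3.IH" "3.prems" skip by blast
    with skip show ?thesis by simp
  qed
qed simp

text \<open>
  Each application of \<open>toggle Y\<close> changes the number of blocks by one, because some block meets \<open>Y\<close>.
  So the sum equals its own negative, which in characteristic zero makes it vanish.
\<close>

lemma signed_sum_first_block_eq_0:
  fixes g :: "set_comp \<Rightarrow> 'a::field_char_0"
  assumes "a \<notin> Y" "A \<inter> Y \<noteq> {}" and g: "\<And>P. g (toggle Y P) = g P"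
  shows "(\<Sum>P | P \<in> set_comps A \<and> a \<in> hd P. (- 1) ^ length P * g P) = 0"
proof -
  let ?S = "{P \<in> set_comps A. a \<in> hd P}"
  have ne: "P \<noteq> []" if "P \<in> set_comps A" for P
    using that assms(2) by (auto simp: set_comps_def)
  have closed: "toggle Y P \<in> ?S" and inv: "toggle Y (toggle Y P) = P"
    and sign: "(- 1 :: 'a) ^ length (toggle Y P) = - ((- 1) ^ length P)" if "P \<in> ?S" for P
  proof -
    have P: "P \<in> set_comps A" "P \<noteq> []" "\<not> hd P \<subseteq> Y"
      using that ne assms(1) by auto
    show "toggle Y (toggle Y P) = P"
      using P by (intro toggle_toggle) (auto simp: set_comps_def)
    have "a \<in> hd (toggle Y P)"
      using hd_toggle_minus[of P Y] P that assms(1) by blast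
    then show "toggle Y P \<in> ?S"
      using P by (auto simp: set_comps_def disjoint_toggle empty_notin_toggle simp del: Union_iff)
    have "\<Union>(set P) \<inter> Y \<noteq> {}" using P assms(2) by (auto simp: set_comps_def)
    from length_toggle[OF this] show "(- 1 :: 'a) ^ length (toggle Y P) = - ((- 1) ^ length P)"
      by auto
  qed
  have "bij_betw (toggle Y) ?S ?S"
    by (rule bij_betw_byWitness[where f' = "toggle Y"]) (use closed inv in auto)
  then have "(\<Sum>P\<in>?S. (- 1) ^ length P * g P)
      = (\<Sum>P\<in>?S. (- 1) ^ length (toggle Y P) * g (toggle Y P))"
    by (rule sum.reindex_bij_betw[symmetric])
  also have "\<dots> = - (\<Sum>P\<in>?S. (- 1) ^ length P * g P)"
    by (simp add: sign g sum_negf)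
  finally show ?thesis by simp
qed

lemma length_le_sum_list: "0 \<notin> set q \<Longrightarrow> length q \<le> sum_list (q :: nat list)"
proof (induction q)
  case (Cons a q)
  then have "length q \<le> sum_list q" "1 \<le> a" by auto
  then show ?case by simp
qed simp

lemma finite_compositions: "finite (compositions n)"
proof (rule finite_subset)
  show "compositions n \<subseteq> {q. set q \<subseteq> {..n} \<and> length q \<le> n}"
    using length_le_sum_list member_le_sum_list by (fastforce simp: compositions_def)
qed (rule finite_lists_length_le, simp)

lemma comp_type_in_compositions:
  assumes "P \<in> set_comps A" "finite A"
  shows "comp_type P \<in> compositions (card A)"
  using assms
proof (induction P arbitrary: A)
  case Nil
  then show ?case by (auto simp: set_comps_def comp_type_def compositions_def)
next
  case (Cons B P)
  note B = set_comps_ConsD[OF Cons.prems(1)]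
  have "comp_type P \<in> compositions (card (A - B))" using Cons B by simp
  moreover have "card B > 0" "card B + card (A - B) = card A"
    using B Cons.prems(2) finite_subset[of B A] card_mono[of A B]
    by (simp_all add: card_gt_0_iff card_Diff_subset)
  ultimately show ?case by (auto simp: comp_type_def compositions_def)
qed

lemma Dynkin_eq:
  assumes "n \<ge> 1"
  shows "Dynkin n = (\<Sum>P\<in>set_comps {1..n}.
    scale ((- 1) ^ (length P - 1) * of_nat (card (hd P))) (basis P))"
proof -
  have "Dynkin n = (\<Sum>q\<in>compositions n. \<Sum>P\<in>{P \<in> set_comps {1..n}. comp_type P = q}.
      scale ((- 1) ^ (length P - 1) * of_nat (card (hd P))) (basis P))"
    unfolding Dynkin_def X_basis_def scale_sum_right
  proof (intro sum.cong refl)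
    fix q P assume "P \<in> {P \<in> set_comps {1..n}. comp_type P = q}"
    then have "length q = length P" "hd q = card (hd P)"
      using assms by (cases P; auto simp: comp_type_def set_comps_def)+
    then show "scale ((- 1) ^ (length q - 1) * of_nat (hd q)) (basis P)
      = scale ((- 1) ^ (length P - 1) * of_nat (card (hd P))) (basis P)" by simp
  qed
  also have "\<dots> = (\<Sum>P\<in>set_comps {1..n}.
      scale ((- 1) ^ (length P - 1) * of_nat (card (hd P))) (basis P))"
    by (rule sum.group)
      (use comp_type_in_compositions[of _ "{1..n}"] in \<open>auto simp: finite_set_comps finite_compositions\<close>)
  finally show ?thesis .
qed

lemma lookup_Dynkin:
  assumes "n \<ge> 1"
  shows "Poly_Mapping.lookup (Dynkin n) P =
    (if P \<in> set_comps {1..n} then (- 1) ^ (length P - 1) * of_nat (card (hd P)) else 0)"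
  by (simp add: Dynkin_eq[OF assms] lookup_sum lookup_basis if_distrib sum.delta finite_set_comps cong: if_cong)

lemma Dynkin_in_FPi_on: "n \<ge> 1 \<Longrightarrow> Dynkin n \<in> FPi_on {1..n}"
  by (auto simp: FPi_on_def in_keys_iff lookup_Dynkin split: if_splits)

text \<open>
  The factor \<open>#Q\<^sub>1\<close> in \<open>\<Omega>\<^sub>n\<close> counts the points \<open>a\<close> of the first block, so the coefficients of the
  product are sums over \<open>a\<close> of signed sums over the \<open>Q\<close> whose first block contains \<open>a\<close>.  Such a sum
  is cancelled by toggling with respect to that one of \<open>X\<close> and \<open>{1..n} - X\<close> not containing \<open>a\<close>.
\<close>

lemma Dynkin_annihilated:
  assumes "n \<ge> 1" "X \<subset> {1..n}" "X \<noteq> {}"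
  shows "basis [X, {1..n} - X] \<and>\<^sub>\<Pi> (Dynkin n :: set_comp \<Rightarrow>\<^sub>0 'a::field_char_0) = 0"
proof (rule poly_mapping_eqI)
  fix k
  let ?A = "{1..n}" and ?Y = "{1..n} - X"
  define g :: "set_comp \<Rightarrow> 'a"
    where "g = (\<lambda>P. if meet_comp [X, ?Y] P = k then 1 else 0)"
  have inv: "g (toggle Z P) = g P" if "Z = X \<or> Z = ?Y" for Z P
  proof -
    have "restrict_comp (toggle Z P) W = restrict_comp P W" if "W = X \<or> W = ?Y" for W
      using \<open>Z = X \<or> Z = ?Y\<close> that by (intro restrict_toggle) blast
    then show ?thesis by (simp add: g_def)
  qed
  have zero: "(\<Sum>P | P \<in> set_comps ?A \<and> a \<in> hd P. (- 1) ^ length P * g P) = 0" if "a \<in> ?A" for a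
  proof (cases "a \<in> X")
    case True
    then show ?thesis using assms inv by (intro signed_sum_first_block_eq_0[where Y = ?Y]) auto
  next
    case False
    then show ?thesis using assms inv by (intro signed_sum_first_block_eq_0[where Y = X]) auto
  qed
  have "Poly_Mapping.lookup (basis [X, ?Y] \<and>\<^sub>\<Pi> (Dynkin n :: set_comp \<Rightarrow>\<^sub>0 'a)) k
      = (\<Sum>P\<in>set_comps ?A. Poly_Mapping.lookup (Dynkin n) P * g P)"
  proof -
    have "basis [X, ?Y] \<and>\<^sub>\<Pi> (Dynkin n :: set_comp \<Rightarrow>\<^sub>0 'a)
        = lin_ext (\<lambda>P. basis (meet_comp [X, ?Y] P)) (Dynkin n)"
      by (rule wedge_basis_FPi_on[OF Dynkin_in_FPi_on]) (use assms in auto)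
    also have "\<dots> = (\<Sum>P\<in>set_comps ?A. scale (Poly_Mapping.lookup (Dynkin n) P) (basis (meet_comp [X, ?Y] P)))"
      using Dynkin_in_FPi_on[OF assms(1)] by (intro lin_ext_superset) (auto simp: finite_set_comps FPi_on_def)
    finally show ?thesis by (simp add: lookup_sum lookup_basis g_def)
  qed
  \<comment> \<open>The outer minus sign turns the exponent \<open>l(Q) - 1\<close> into \<open>l(Q)\<close>.\<close>
  also have "\<dots> = (\<Sum>P\<in>set_comps ?A. \<Sum>a\<in>?A. if a \<in> hd P then - ((- 1) ^ length P * g P) else 0)"
  proof (rule sum.cong)
    fix P assume P: "P \<in> set_comps ?A"
    then obtain B R where BR: "P = B # R" using assms(1) by (cases P) (auto simp: set_comps_def)
    then have "?A \<inter> hd P = hd P" using P by (auto simp: set_comps_def)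
    then show "Poly_Mapping.lookup (Dynkin n) P * g P
        = (\<Sum>a\<in>?A. if a \<in> hd P then - ((- 1) ^ length P * g P) else 0)"
      using P BR by (simp add: lookup_Dynkin[OF assms(1)] flip: sum.inter_restrict)
  qed simp
  also have "\<dots> = (\<Sum>a\<in>?A. \<Sum>P\<in>set_comps ?A. if a \<in> hd P then - ((- 1) ^ length P * g P) else 0)"
    by (rule sum.swap)
  also have "\<dots> = (\<Sum>a\<in>?A. - (\<Sum>P | P \<in> set_comps ?A \<and> a \<in> hd P. (- 1) ^ length P * g P))"
    by (simp add: sum.inter_filter[symmetric] finite_set_comps sum_negf)
  also have "\<dots> = 0" using zero by simp
  finally show "Poly_Mapping.lookup (basis [X, ?Y] \<and>\<^sub>\<Pi> (Dynkin n :: set_comp \<Rightarrow>\<^sub>0 'a)) k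
      = Poly_Mapping.lookup 0 k" by simp
qed

section \<open>Lie idempotents\<close>

lemma FPi_on_subset_FPi: "finite A \<Longrightarrow> A \<subseteq> {1..} \<Longrightarrow> FPi_on A \<subseteq> FPi"
  unfolding FPi_def FPi_on_def by blast

theorem proposition9p2:
  fixes n :: nat
  assumes "n \<ge> 1"
  shows "{E \<in> (B_alg n :: (set_comp \<Rightarrow>\<^sub>0 'a::field_char_0) set). delta_primitive_idempotent E}
       = {E. Lie_idempotent n E}"
proof -
  let ?A = "{1..n}" and ?D = "Dynkin n :: set_comp \<Rightarrow>\<^sub>0 'a"
  let ?ann = "\<lambda>E :: set_comp \<Rightarrow>\<^sub>0 'a. \<forall>X. X \<subset> ?A \<and> X \<noteq> {} \<longrightarrow> basis [X, ?A - X] \<and>\<^sub>\<Pi> E = 0"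
  have A: "finite ?A" "?A \<noteq> {}" using assms by auto
  have "[?A] \<in> set_comps ?A" using A by (simp add: set_comps_def)
  then have D_top: "Poly_Mapping.lookup ?D [?A] = of_nat n"
    by (simp add: lookup_Dynkin[OF assms])
  have D: "?D \<in> FPi_on ?A" by (rule Dynkin_in_FPi_on[OF assms])
  have D0: "?D \<noteq> 0" using D_top assms by auto
  have scale_eq_self: "scale c x = x \<longleftrightarrow> c = 1" if x: "x \<noteq> 0" for c and x :: "set_comp \<Rightarrow>\<^sub>0 'a"
  proof
    assume eq: "scale c x = x"
    obtain k where "Poly_Mapping.lookup x k \<noteq> 0"
      using x poly_mapping_eqI[of x 0] by auto
    then show "c = 1"
      using arg_cong[OF eq, of "\<lambda>y. Poly_Mapping.lookup y k"] by simp
  qed simp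
  have right_D: "E \<and>\<^sub>\<Pi> ?D = ?D \<longleftrightarrow> Poly_Mapping.lookup E [?A] = 1" if "E \<in> FPi_on ?A" for E
    by (subst wedge_annihilated[OF that D A(2) Dynkin_annihilated[OF assms]])
      (simp_all add: scale_eq_self[OF D0])
  have "delta_primitive_idempotent E \<longleftrightarrow> Lie_idempotent n E" if E: "E \<in> B_alg n" for E :: "set_comp \<Rightarrow>\<^sub>0 'a"
  proof -
    have EA: "E \<in> FPi_on ?A" using E by (simp add: B_alg_def)
    then have "E \<in> FPi"
      using FPi_on_subset_FPi[OF A(1)] by auto
    then have "delta_primitive_idempotent E \<longleftrightarrow> E \<noteq> 0 \<and> ?ann E \<and> E \<and>\<^sub>\<Pi> E = E"
      by (simp add: delta_primitive_idempotent_def primitive_iff_annihilated[OF EA A])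
    also have "\<dots> \<longleftrightarrow> ?ann E \<and> Poly_Mapping.lookup E [?A] = 1"
    proof (cases "?ann E \<and> E \<noteq> 0")
      case True
      then have "E \<and>\<^sub>\<Pi> E = scale (Poly_Mapping.lookup E [?A]) E"
        by (intro wedge_annihilated[OF EA EA A(2)]) blast
      with True scale_eq_self[of E] show ?thesis by simp
    next
      case False
      then show ?thesis by auto
    qed
    also have "\<dots> \<longleftrightarrow> ?D \<and>\<^sub>\<Pi> E = scale (of_nat n) E \<and> Poly_Mapping.lookup E [?A] = 1"
    proof (intro conj_cong refl iffI)
      assume "?ann E"
      then show "?D \<and>\<^sub>\<Pi> E = scale (of_nat n) E"
        by (subst wedge_annihilated[OF D EA A(2)]) (blast, simp only: D_top)
    next
      assume eq: "?D \<and>\<^sub>\<Pi> E = scale (of_nat n) E"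
      show "?ann E"
      proof (intro allI impI)
        fix X assume X: "X \<subset> ?A \<and> X \<noteq> {}"
        have "scale (of_nat n) (basis [X, ?A - X] \<and>\<^sub>\<Pi> E) = basis [X, ?A - X] \<and>\<^sub>\<Pi> (?D \<and>\<^sub>\<Pi> E)"
          by (simp add: eq wedge_scale_right)
        also have "\<dots> = 0"
          using X Dynkin_annihilated[OF assms, of X, where 'a = 'a]
          by (simp flip: wedge_assoc)
        finally have "scale (inverse (of_nat n)) (scale (of_nat n) (basis [X, ?A - X] \<and>\<^sub>\<Pi> E)) = 0"
          by simp
        then show "basis [X, ?A - X] \<and>\<^sub>\<Pi> E = 0" using assms by simp
      qed
    qed
    also have "\<dots> \<longleftrightarrow> Lie_idempotent n E"
      using E right_D[OF EA] by (simp add: Lie_idempotent_def)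
    finally show ?thesis .
  qed
  then show ?thesis by (auto simp: Lie_idempotent_def)
qed

end
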